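(* Let $D:V\to V$ be the multiblock difference operator $D=H^{-1}E^TH^{(+)}D^{(+)}E$. Then (i) $D$ satisfies summation by parts with respect to the inner product $(\cdot,\cdot)$ of $V$: for all $u,v\in V$, $(u,Dv)=u_Nv_N-u_0v_0-(Du,v)$. (ii) $D$ is a consistent approximation of $\partial/\partial x$. (iii) $D=E^+D^{(+)}E$.
   Context: Let $\Omega_1=[0,1/2]$ and $\Omega_2=[1/2,1]$ have uniform grids with $N^{(1)}+1$ and $N^{(2)}+1$ points and mesh sizes $h^{(i)}=1/(2N^{(i)})$; put $N=N^{(1)}+N^{(2)}$. On each $\Omega_i$ there is a symmetric positive definite matrix $H^{(i)}\in\mathbb{R}^{(N^{(i)}+1)\times(N^{(i)}+1)}$, an inner product $(u^{(i)},v^{(i)})_i=[u^{(i)}]^TH^{(i)}v^{(i)}$, and a difference operator $D^{(i)}$ that is a consistent approximation of $\partial/\partial x$ and satisfies $(u^{(i)},D^{(i)}v^{(i)})_i=u^{(i)}_{N^{(i)}}v^{(i)}_{N^{(i)}}-u^{(i)}_0v^{(i)}_0-(D^{(i)}u^{(i)},v^{(i)})_i$ for all grid vectors. Put $H^{(+)}=\mathrm{diag}(H^{(1)},H^{(2)})$ and $D^{(+)}=\mathrm{diag}(D^{(1)},D^{(2)})$; $V_+=\mathbb{R}^{N+2}$ has inner product $(a,b)_+=a^TH^{(+)}b$. The embedding $E\in\mathbb{R}^{(N+2)\times(N+1)}$ maps $u=(u_0,\dots,u_N)^T$ to $Eu=(u^{(1)};u^{(2)})$ with $u^{(1)}_k=u_k$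 for $0\le k\le N^{(1)}$ and $u^{(2)}_k=u_{N^{(1)}+k}$ for $0\le k\le N^{(2)}$ (the interface value is duplicated). $V=\mathbb{R}^{N+1}$ has inner product $(u,v)=u^THv$ with $H=E^TH^{(+)}E$ (symmetric positive definite). $E^+$ is the Moore–Penrose pseudoinverse of $E:V\to V_+$: the unique linear operator $V_+\to V$ with $EE^+E=E$, $E^+EE^+=E^+$, and $E^+E$, $EE^+$ self-adjoint in $V$, $V_+$ respectively. "Consistent approximation of $\partial/\partial x$" has its usual finite-difference meaning: applied to the vector of grid values of a smooth function $u(x)$, the difference operator returns the vector of grid values of $u_x$ up to a truncation error $\mathcal{O}(h^p)$, where $h$ denotes the mesh size and $p$ the order of accuracy.
   Formalization: In (ii) the truncation error is measured in the norms of V_1, V_2, V; the componentwise version additionally assumes that the H^(i) are equivalent, uniformly in the grid, to the discrete L^2 norms, since it fails for arbitrary symmetric positive definite H^(i). *)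

theory Defs
  imports
    Complex_Main
    "HOL-Library.Landau_Symbols"
    "Jordan_Normal_Form.Matrix"
    "Jordan_Normal_Form.Gauss_Jordan_Elimination"
begin

subsection \<open>Discrete inner products and summation by parts\<close>

definition sym_pos_def :: "nat \<Rightarrow> real mat \<Rightarrow> bool" where
  "sym_pos_def n A \<longleftrightarrow> A \<in> carrier_mat n n \<and> transpose_mat A = A \<and>
     (\<forall>x\<in>carrier_vec n. x \<noteq> 0\<^sub>v n \<longrightarrow> x \<bullet> (A *\<^sub>v x) > 0)"

definition inner_mat :: "real mat \<Rightarrow> real vec \<Rightarrow> real vec \<Rightarrow> real" where
  "inner_mat H u v = u \<bullet> (H *\<^sub>v v)"

text \<open>Grid vectors \<open>(u\<^sub>0, \<dots>, u\<^sub>n)\<close> have length \<open>n + 1\<close>; \<open>n\<close> is the index of the last grid point.\<close>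

definition summation_by_parts :: "nat \<Rightarrow> real mat \<Rightarrow> real mat \<Rightarrow> bool" where
  "summation_by_parts n H D \<longleftrightarrow>
     (\<forall>u\<in>carrier_vec (n + 1). \<forall>v\<in>carrier_vec (n + 1).
        inner_mat H u (D *\<^sub>v v) = u $ n * v $ n - u $ 0 * v $ 0 - inner_mat H (D *\<^sub>v u) v)"

subsection \<open>The multiblock construction\<close>

text \<open>
  Rows \<open>0, \<dots>, n1\<close> of \<open>E u\<close> are block 1, row \<open>n1 + 1 + k\<close> is entry \<open>k\<close> of block 2,
  i.e. \<open>u\<close> at index \<open>n1 + k\<close>.
\<close>

definition embedding :: "nat \<Rightarrow> nat \<Rightarrow> real mat" where
  "embedding n1 n2 = mat (n1 + n2 + 2) (n1 + n2 + 1)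
     (\<lambda>(r, c). if c = (if r \<le> n1 then r else r - 1) then 1 else 0)"

definition block_diag :: "real mat \<Rightarrow> real mat \<Rightarrow> real mat" where
  "block_diag A B = diag_block_mat [A, B]"

definition multiblock_norm :: "nat \<Rightarrow> nat \<Rightarrow> real mat \<Rightarrow> real mat \<Rightarrow> real mat" where
  "multiblock_norm n1 n2 H1 H2 =
     transpose_mat (embedding n1 n2) * block_diag H1 H2 * embedding n1 n2"

definition multiblock_diff ::
  "nat \<Rightarrow> nat \<Rightarrow> real mat \<Rightarrow> real mat \<Rightarrow> real mat \<Rightarrow> real mat \<Rightarrow> real mat" where
  "multiblock_diff n1 n2 H1 H2 D1 D2 =
     the (mat_inverse (multiblock_norm n1 n2 H1 H2)) * transpose_mat (embedding n1 n2) *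
       block_diag H1 H2 * block_diag D1 D2 * embedding n1 n2"

text \<open>
  Moore--Penrose pseudoinverse of \<open>A : \<real>\<^sup>n \<rightarrow> \<real>\<^sup>m\<close>, where \<open>\<real>\<^sup>n\<close> and \<open>\<real>\<^sup>m\<close> carry the inner products
  given by \<open>G\<close> and \<open>K\<close>.
\<close>

definition self_adjoint :: "nat \<Rightarrow> real mat \<Rightarrow> real mat \<Rightarrow> bool" where
  "self_adjoint n G A \<longleftrightarrow>
     (\<forall>u\<in>carrier_vec n. \<forall>v\<in>carrier_vec n. inner_mat G u (A *\<^sub>v v) = inner_mat G (A *\<^sub>v u) v)"

definition is_pseudoinverse ::
  "nat \<Rightarrow> nat \<Rightarrow> real mat \<Rightarrow> real mat \<Rightarrow> real mat \<Rightarrow> real mat \<Rightarrow> bool" where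
  "is_pseudoinverse n m G K A P \<longleftrightarrow>
     P \<in> carrier_mat n m \<and> A * P * A = A \<and> P * A * P = P \<and>
     self_adjoint n G (P * A) \<and> self_adjoint m K (A * P)"

definition pseudoinverse ::
  "nat \<Rightarrow> nat \<Rightarrow> real mat \<Rightarrow> real mat \<Rightarrow> real mat \<Rightarrow> real mat" where
  "pseudoinverse n m G K A = (THE P. is_pseudoinverse n m G K A P)"

subsection \<open>Grids\<close>

text \<open>Both blocks have length \<open>1/2\<close>.\<close>

definition mesh_size :: "nat \<Rightarrow> real" where
  "mesh_size n = 1 / (2 * real n)"

definition uniform_grid :: "real \<Rightarrow> nat \<Rightarrow> real vec" where
  "uniform_grid a n = vec (n + 1) (\<lambda>k. a + real k * mesh_size n)"

definition multiblock_grid :: "nat \<Rightarrow> nat \<Rightarrow> real vec" where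
  "multiblock_grid n1 n2 = vec (n1 + n2 + 1)
     (\<lambda>k. if k \<le> n1 then real k * mesh_size n1 else 1/2 + real (k - n1) * mesh_size n2)"

subsection \<open>Consistency\<close>

text \<open>Smoothness up to the boundary: derivatives of all orders exist, one-sided at endpoints.\<close>

definition smooth_on :: "real set \<Rightarrow> (real \<Rightarrow> real) \<Rightarrow> bool" where
  "smooth_on S u \<longleftrightarrow> (\<exists>g :: nat \<Rightarrow> real \<Rightarrow> real. g 0 = u \<and>
     (\<forall>k. \<forall>t\<in>S. (g k has_real_derivative g (Suc k) t) (at t within S)))"

text \<open>
  Order of accuracy is an asymptotic notion, so it refers to a sequence of grids: at refinement
  level \<open>j\<close>, \<open>x j\<close> is the vector of grid points in \<open>S\<close>, \<open>h j\<close> the mesh size, \<open>D j\<close> the difference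
  operator, and \<open>nrm j\<close> the norm in which the vector of truncation errors is measured.
\<close>

definition consistent_of_order ::
  "(nat \<Rightarrow> real vec \<Rightarrow> real) \<Rightarrow> real set \<Rightarrow> (nat \<Rightarrow> real vec) \<Rightarrow> (nat \<Rightarrow> real) \<Rightarrow>
     (nat \<Rightarrow> real mat) \<Rightarrow> real \<Rightarrow> bool" where
  "consistent_of_order nrm S x h D p \<longleftrightarrow>
     (\<forall>u u'. smooth_on S u \<and> (\<forall>t\<in>S. (u has_real_derivative u' t) (at t within S)) \<longrightarrow>
        (\<lambda>j. nrm j (D j *\<^sub>v map_vec u (x j) - map_vec u' (x j))) \<in> O(\<lambda>j. h j powr p))"

definition inner_norm :: "real mat \<Rightarrow> real vec \<Rightarrow> real" where
  "inner_norm H e = sqrt (inner_mat H e e)"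

definition max_norm :: "real vec \<Rightarrow> real" where
  "max_norm e = Max ((\<lambda>k. \<bar>e $ k\<bar>) ` {..<dim_vec e})"

text \<open>
  The norms given by \<open>H j\<close> are equivalent, uniformly in \<open>j\<close>, to the discrete \<open>L\<^sup>2\<close> norms on grids with
  \<open>n j + 1\<close> points. Symmetric positive definiteness at each level does not imply this.
\<close>

definition uniform_L2_equiv :: "(nat \<Rightarrow> nat) \<Rightarrow> (nat \<Rightarrow> real mat) \<Rightarrow> bool" where
  "uniform_L2_equiv n H \<longleftrightarrow> (\<exists>c>0. \<exists>C. \<forall>j. \<forall>x\<in>carrier_vec (n j + 1).
     c * (mesh_size (n j) * (x \<bullet> x)) \<le> inner_mat (H j) x x \<and>
     inner_mat (H j) x x \<le> C * (mesh_size (n j) * (x \<bullet> x)))"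

end

theory Submission
  imports Defs "Jordan_Normal_Form.Determinant"
begin

text \<open>
  The embedding \<open>E\<close> is injective, and the inner product \<open>H = E\<^sup>T H\<^sup>(\<^sup>+\<^sup>) E\<close> is the one that makes it an
  isometry. Therefore \<open>H\<^sup>-\<^sup>1 E\<^sup>T H\<^sup>(\<^sup>+\<^sup>)\<close> is the adjoint of \<open>E\<close>, which for an isometry is also its
  Moore-Penrose pseudoinverse \<open>E\<^sup>+\<close>: a left inverse of \<open>E\<close> for which \<open>E E\<^sup>+\<close> is the orthogonal
  projection onto the range of \<open>E\<close>. The locale \<open>isometric_embedding\<close> develops this for injective
  matrices (\<open>pseudoinverse_eq_retraction\<close>), and the formula \<open>D = E\<^sup>+ D\<^sup>(\<^sup>+\<^sup>) E\<close> is immediate.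

  Summation by parts follows from adjointness, \<open>(u, E\<^sup>+ a) = (E u, a)\<^sub>+\<close>: the product \<open>(u, D v)\<close>
  becomes the sum of the block products, and the two boundary terms at the duplicated interface
  point cancel.

  For consistency, let \<open>e1\<close> and \<open>e2\<close> be the truncation errors of the blocks. Since
  \<open>E\<^sup>+ E = 1\<close>, the multiblock truncation error is \<open>E\<^sup>+ (e1, e2)\<close> (\<open>truncation_error\<close>), so a bound
  on \<open>E\<^sup>+\<close> independent of the refinement level is enough (\<open>multiblock_consistent\<close>). In the weighted
  norms \<open>E\<^sup>+\<close> is a contraction (\<open>retraction_contraction\<close>). In the maximum norm it need not be one,
  and there the bound comes from the uniform equivalence to the discrete \<open>L\<^sup>2\<close> norms. The residual of
  the projection lies in the orthogonal complement of the range of \<open>E\<close>, a line: in each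
  block, the weight matrix maps the residual to a multiple of the interface unit vector. A
  Cauchy-Schwarz argument bounds such a vector by its interface entry with a constant free of the
  mesh size (\<open>concentrated_residual_bound\<close>), and the interface entries are bounded by the jump of
  \<open>(e1, e2)\<close> across the interface (\<open>max_norm_retraction_le\<close>).
\<close>

section \<open>Weighted inner products\<close>

lemma inner_mat_add_right:
  assumes "H \<in> carrier_mat n n" "u \<in> carrier_vec n" "v \<in> carrier_vec n" "w \<in> carrier_vec n"
  shows "inner_mat H u (v + w) = inner_mat H u v + inner_mat H u w"
  using assms unfolding inner_mat_def
  by (simp add: mult_add_distrib_mat_vec[of H n n] scalar_prod_add_distrib[of _ n])

lemma inner_mat_add_left:
  assumes "H \<in> carrier_mat n n" "u \<in> carrier_vec n" "v \<in> carrier_vec n" "w \<in> carrier_vec n"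
  shows "inner_mat H (u + v) w = inner_mat H u w + inner_mat H v w"
  using assms unfolding inner_mat_def
  by (simp add: add_scalar_prod_distrib[of _ n])

lemma inner_mat_smult_left:
  assumes "H \<in> carrier_mat n n" "u \<in> carrier_vec n" "v \<in> carrier_vec n"
  shows "inner_mat H (c \<cdot>\<^sub>v u) v = c * inner_mat H u v"
  using assms unfolding inner_mat_def by simp

lemma inner_mat_smult_right:
  assumes "H \<in> carrier_mat n n" "u \<in> carrier_vec n" "v \<in> carrier_vec n"
  shows "inner_mat H u (c \<cdot>\<^sub>v v) = c * inner_mat H u v"
  using assms unfolding inner_mat_def by (simp add: mult_mat_vec[of H n n])

text \<open>The defining property of the transpose, with the matrix on the right as it occurs in
  \<open>inner_mat\<close>.\<close>

lemma scalar_prod_mult_mat_vec: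
  fixes A :: "real mat"
  assumes "A \<in> carrier_mat m n" "u \<in> carrier_vec n" "y \<in> carrier_vec m"
  shows "u \<bullet> (transpose_mat A *\<^sub>v y) = (A *\<^sub>v u) \<bullet> y"
proof -
  have "u \<bullet> (transpose_mat A *\<^sub>v y) = (transpose_mat A *\<^sub>v y) \<bullet> u"
    using assms by (intro comm_scalar_prod[of _ n]) auto
  also have "\<dots> = y \<bullet> (A *\<^sub>v u)" using assms by (intro transpose_vec_mult_scalar) auto
  also have "\<dots> = (A *\<^sub>v u) \<bullet> y"
    using assms by (intro comm_scalar_prod[of _ m]) auto
  finally show ?thesis .
qed

lemma sym_pos_def_carrier: "sym_pos_def n H \<Longrightarrow> H \<in> carrier_mat n n"
  by (simp add: sym_pos_def_def)

lemma inner_mat_commute: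
  assumes "sym_pos_def n H" "u \<in> carrier_vec n" "v \<in> carrier_vec n"
  shows "inner_mat H u v = inner_mat H v u"
proof -
  have H: "H \<in> carrier_mat n n" "transpose_mat H = H" using assms by (auto simp: sym_pos_def_def)
  have "u \<bullet> (H *\<^sub>v v) = (H *\<^sub>v u) \<bullet> v"
    using scalar_prod_mult_mat_vec[OF H(1) assms(2,3)] H(2) by simp
  also have "\<dots> = v \<bullet> (H *\<^sub>v u)"
    using assms H by (intro comm_scalar_prod[of _ n]) auto
  finally show ?thesis by (simp add: inner_mat_def)
qed

lemma inner_mat_pos:
  assumes "sym_pos_def n H" "u \<in> carrier_vec n" "u \<noteq> 0\<^sub>v n"
  shows "inner_mat H u u > 0"
  using assms by (auto simp: sym_pos_def_def inner_mat_def)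

lemma inner_mat_nonneg:
  assumes "sym_pos_def n H" "u \<in> carrier_vec n"
  shows "inner_mat H u u \<ge> 0"
proof (cases "u = 0\<^sub>v n")
  case True
  moreover have "H *\<^sub>v 0\<^sub>v n \<in> carrier_vec n" using sym_pos_def_carrier[OF assms(1)] by simp
  ultimately show ?thesis by (simp add: inner_mat_def)
qed (use inner_mat_pos[OF assms] in simp)

lemma inner_mat_Cauchy_Schwarz:
  assumes H: "sym_pos_def n H" and u: "u \<in> carrier_vec n" and v: "v \<in> carrier_vec n"
  shows "(inner_mat H u v)\<^sup>2 \<le> inner_mat H u u * inner_mat H v v"
proof (cases "v = 0\<^sub>v n")
  case True
  have "H *\<^sub>v v = 0\<^sub>v n" using True sym_pos_def_carrier[OF H] by (intro eq_vecI) auto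
  then show ?thesis using u v by (simp add: inner_mat_def)
next
  case False
  note [simp] = inner_mat_add_left[of _ n] inner_mat_add_right[of _ n]
    inner_mat_smult_left[of _ n] inner_mat_smult_right[of _ n]
  \<comment> \<open>The vector \<open>s u - a v\<close> is \<open>s\<close> times the component of \<open>u\<close> orthogonal to \<open>v\<close>; its squared norm
    is nonnegative, and scaling by \<open>s\<close> avoids a division.\<close>
  define s where "s = inner_mat H v v"
  define a where "a = inner_mat H u v"
  have s: "s > 0" using inner_mat_pos[OF H v False] by (simp add: s_def)
  have "0 \<le> inner_mat H (s \<cdot>\<^sub>v u + (- a) \<cdot>\<^sub>v v) (s \<cdot>\<^sub>v u + (- a) \<cdot>\<^sub>v v)"
    using u v by (intro inner_mat_nonneg[OF H]) auto
  also have "\<dots> = s * (inner_mat H u u * s - a\<^sup>2)"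
    using u v sym_pos_def_carrier[OF H] inner_mat_commute[OF H v u]
    by (simp add: algebra_simps power2_eq_square flip: s_def a_def)
  finally show ?thesis using s by (simp add: zero_le_mult_iff s_def a_def)
qed

lemma sym_pos_def_inverse:
  assumes "sym_pos_def n G"
  obtains Gi where "mat_inverse G = Some Gi" "Gi \<in> carrier_mat n n" "G * Gi = 1\<^sub>m n" "Gi * G = 1\<^sub>m n"
proof -
  have G: "G \<in> carrier_mat n n" using assms by (rule sym_pos_def_carrier)
  have "det G \<noteq> 0"
  proof
    assume "det G = 0"
    then obtain v where "v \<in> carrier_vec n" "v \<noteq> 0\<^sub>v n" "G *\<^sub>v v = 0\<^sub>v n"
      using det_0_iff_vec_prod_zero_field[OF G] by auto
    then show False using inner_mat_pos[OF assms, of v] by (simp add: inner_mat_def)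
  qed
  then have "G \<in> Units (ring_mat TYPE(real) n ())" by (rule det_non_zero_imp_unit[OF G])
  then obtain Gi where "mat_inverse G = Some Gi"
    using mat_inverse(1)[OF G, of "()"] by (cases "mat_inverse G") auto
  with mat_inverse(2)[OF G this] that show ?thesis by auto
qed

section \<open>Pseudoinverses of isometric embeddings\<close>

text \<open>
  Let \<open>A\<close> be injective and pull the inner product \<open>K\<close> of the target back along \<open>A\<close>, that is, give
  the source the inner product \<open>G = A\<^sup>T K A\<close>. Then \<open>A\<close> is an isometry onto its range, so its
  pseudoinverse is its adjoint \<open>G\<^sup>-\<^sup>1 A\<^sup>T K\<close>: the least-squares left inverse of \<open>A\<close>, whose
  composite with \<open>A\<close> is the \<open>K\<close>-orthogonal projection onto the range.
\<close>

lemma inner_mat_congruence: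
  assumes "K \<in> carrier_mat m m" "A \<in> carrier_mat m n" "u \<in> carrier_vec n" "v \<in> carrier_vec n"
  shows "inner_mat (transpose_mat A * K * A) u v = inner_mat K (A *\<^sub>v u) (A *\<^sub>v v)"
proof -
  have "(transpose_mat A * K * A) *\<^sub>v v = transpose_mat A *\<^sub>v (K *\<^sub>v (A *\<^sub>v v))"
    using assms by (simp add: assoc_mult_mat_vec[of _ n m] assoc_mult_mat_vec[of _ n m _ n])
  then show ?thesis using assms scalar_prod_mult_mat_vec[of A m n u "K *\<^sub>v (A *\<^sub>v v)"]
    by (simp add: inner_mat_def)
qed

locale isometric_embedding =
  fixes m n :: nat and K A G :: "real mat"
  assumes K: "sym_pos_def m K"
    and A: "A \<in> carrier_mat m n"
    and inj: "\<And>v. v \<in> carrier_vec n \<Longrightarrow> A *\<^sub>v v = 0\<^sub>v m \<Longrightarrow> v = 0\<^sub>v n"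
    and G: "G = transpose_mat A * K * A"
begin

lemma carriers: "K \<in> carrier_mat m m" "G \<in> carrier_mat n n" "transpose_mat A \<in> carrier_mat n m"
  using sym_pos_def_carrier[OF K] A G by auto

lemma pulled_back_sym_pos_def: "sym_pos_def n G"
  unfolding sym_pos_def_def
proof (intro conjI ballI impI)
  have KT: "transpose_mat K = K" using K by (simp add: sym_pos_def_def)
  have "transpose_mat (transpose_mat A * (K * A)) = transpose_mat (K * A) * A"
    using transpose_mult[of "transpose_mat A" n m "K * A" n] A carriers by simp
  also have "transpose_mat (K * A) = transpose_mat A * K"
    using transpose_mult[OF carriers(1) A] KT by simp
  finally show "transpose_mat G = G"
    unfolding G using A carriers by (simp add: assoc_mult_mat[of _ n m _ m _ n])
next
  fix x :: "real vec" assume x: "x \<in> carrier_vec n" "x \<noteq> 0\<^sub>v n"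
  then have "inner_mat K (A *\<^sub>v x) (A *\<^sub>v x) > 0"
    using inj[of x] A by (intro inner_mat_pos[OF K]) auto
  then show "x \<bullet> (G *\<^sub>v x) > 0"
    using inner_mat_congruence[OF carriers(1) A x(1) x(1)] by (simp add: G inner_mat_def)
qed (rule carriers)

text \<open>The adjoint of \<open>A\<close>, in the form in which it occurs in the multiblock operator. The inverse
  exists because \<open>G\<close> is positive definite.\<close>

definition retraction :: "real mat" where
  "retraction = the (mat_inverse G) * transpose_mat A * K"

lemma retraction_carrier: "retraction \<in> carrier_mat n m"
  and retraction_normal_equation: "G * retraction = transpose_mat A * K"
  and retraction_left_inverse: "retraction * A = 1\<^sub>m n"
proof -
  obtain Gi where Gi: "mat_inverse G = Some Gi" "Gi \<in> carrier_mat n n" "G * Gi = 1\<^sub>m n" "Gi * G = 1\<^sub>m n"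
    using sym_pos_def_inverse[OF pulled_back_sym_pos_def] .
  have AK: "transpose_mat A * K \<in> carrier_mat n m" using carriers by auto
  have R: "retraction = Gi * (transpose_mat A * K)"
    using Gi carriers by (simp add: retraction_def assoc_mult_mat[of _ n n _ m _ m])
  show "retraction \<in> carrier_mat n m" using R Gi carriers by auto
  have "G * retraction = (G * Gi) * (transpose_mat A * K)"
    using R Gi(2) carriers(2) AK assoc_mult_mat[of G n n Gi n _ m] by simp
  then show "G * retraction = transpose_mat A * K" using Gi(3) left_mult_one_mat[OF AK] by metis
  have "retraction * A = Gi * G"
    using R Gi AK A by (simp add: G assoc_mult_mat[of _ n n _ m _ n])
  then show "retraction * A = 1\<^sub>m n" using Gi by simp
qed

text \<open>Adjointness. It trades the inner product of the source, and with it the inverse of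
  \<open>G\<close>, for the inner product of the target.\<close>

lemma inner_mat_retraction:
  assumes "v \<in> carrier_vec n" "a \<in> carrier_vec m"
  shows "inner_mat G v (retraction *\<^sub>v a) = inner_mat K (A *\<^sub>v v) a"
proof -
  have "G *\<^sub>v (retraction *\<^sub>v a) = (transpose_mat A * K) *\<^sub>v a"
    using assms carriers retraction_carrier retraction_normal_equation
    by (simp flip: assoc_mult_mat_vec[of _ n n _ m])
  also have "\<dots> = transpose_mat A *\<^sub>v (K *\<^sub>v a)"
    using assms carriers by simp
  finally show ?thesis
    using assms carriers scalar_prod_mult_mat_vec[OF A, of v "K *\<^sub>v a"] by (simp add: inner_mat_def)
qed

text \<open>The normal equations of the least-squares problem. The residual \<open>r\<close> is a variable so that it
  may later be a concatenation of two block vectors.\<close>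

lemma residual_orthogonal:
  assumes v: "v \<in> carrier_vec n" and a: "a \<in> carrier_vec m" and r: "r \<in> carrier_vec m"
    and dec: "a = A *\<^sub>v (retraction *\<^sub>v a) + r"
  shows "inner_mat K (A *\<^sub>v v) r = 0"
proof -
  have Pa: "retraction *\<^sub>v a \<in> carrier_vec n" using retraction_carrier a by simp
  have "inner_mat K (A *\<^sub>v v) a = inner_mat K (A *\<^sub>v v) (A *\<^sub>v (retraction *\<^sub>v a)) + inner_mat K (A *\<^sub>v v) r"
    using dec inner_mat_add_right[OF carriers(1), of "A *\<^sub>v v" "A *\<^sub>v (retraction *\<^sub>v a)" r] A v Pa r
    by simp
  then show ?thesis
    using inner_mat_retraction[OF v a] inner_mat_congruence[OF carriers(1) A v Pa] by (simp add: G)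
qed

text \<open>Pythagoras: \<open>a\<close> is the orthogonal sum of its projection and the residual, and \<open>A\<close> is an
  isometry.\<close>

lemma retraction_contraction:
  assumes a: "a \<in> carrier_vec m"
  shows "inner_mat G (retraction *\<^sub>v a) (retraction *\<^sub>v a) \<le> inner_mat K a a"
proof -
  define e where "e = A *\<^sub>v (retraction *\<^sub>v a)"
  define r where "r = a - e"
  have Pa: "retraction *\<^sub>v a \<in> carrier_vec n" using retraction_carrier a by simp
  have c: "e \<in> carrier_vec m" "r \<in> carrier_vec m" using A a Pa by (auto simp: e_def r_def)
  have dec: "a = e + r" using c a by (intro eq_vecI) (auto simp: r_def)
  have er: "inner_mat K e r = 0"
    unfolding e_def by (rule residual_orthogonal[OF Pa a c(2) dec[unfolded e_def]])
  have "inner_mat K a a = inner_mat K e e + inner_mat K r r"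
    using er inner_mat_commute[OF K c] c carriers(1)
    by (simp add: dec inner_mat_add_left[of _ m] inner_mat_add_right[of _ m])
  moreover have "inner_mat G (retraction *\<^sub>v a) (retraction *\<^sub>v a) = inner_mat K e e"
    using inner_mat_congruence[OF carriers(1) A Pa Pa] by (simp add: e_def G)
  ultimately show ?thesis using inner_mat_nonneg[OF K c(2)] by simp
qed

lemma is_pseudoinverse_retraction: "is_pseudoinverse n m G K A retraction"
  unfolding is_pseudoinverse_def
proof (intro conjI)
  note R = retraction_carrier
  show "retraction \<in> carrier_mat n m" by (rule R)
  show "A * retraction * A = A"
    using R A retraction_left_inverse by (simp add: assoc_mult_mat[of _ m n _ m _ n])
  show "retraction * A * retraction = retraction"
    using R retraction_left_inverse by simp
  show "self_adjoint n G (retraction * A)"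
    using retraction_left_inverse by (simp add: self_adjoint_def)
  show "self_adjoint m K (A * retraction)"
    unfolding self_adjoint_def
  proof (intro ballI)
    fix u v :: "real vec" assume uv: "u \<in> carrier_vec m" "v \<in> carrier_vec m"
    have c: "retraction *\<^sub>v u \<in> carrier_vec n" "retraction *\<^sub>v v \<in> carrier_vec n" using R uv by auto
    have ct: "A *\<^sub>v (retraction *\<^sub>v u) \<in> carrier_vec m" "A *\<^sub>v (retraction *\<^sub>v v) \<in> carrier_vec m"
      using A c by auto
    have "inner_mat K u (A *\<^sub>v (retraction *\<^sub>v v)) = inner_mat G (retraction *\<^sub>v v) (retraction *\<^sub>v u)"
      using inner_mat_retraction[OF c(2) uv(1)] inner_mat_commute[OF K uv(1) ct(2)] by simp
    also have "\<dots> = inner_mat K (A *\<^sub>v (retraction *\<^sub>v u)) v"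
      using inner_mat_retraction[OF c(1) uv(2)] inner_mat_commute[OF pulled_back_sym_pos_def c] by simp
    finally show "inner_mat K u (A * retraction *\<^sub>v v) = inner_mat K (A * retraction *\<^sub>v u) v"
      using uv A R by simp
  qed
qed

text \<open>Testing self-adjointness on unit vectors turns it into an identity of matrices.\<close>

lemma self_adjoint_transpose:
  assumes "self_adjoint m K B" "B \<in> carrier_mat m m"
  shows "K * B = transpose_mat B * K"
proof (rule eq_matI)
  fix i j assume "i < dim_row (transpose_mat B * K)" "j < dim_col (transpose_mat B * K)"
  then have ij: "i < m" "j < m" using assms carriers by auto
  have el: "unit_vec m i \<bullet> (M *\<^sub>v unit_vec m j) = M $$ (i, j)" if "M \<in> carrier_mat m m" for M :: "real mat"
    using that ij by (simp add: scalar_prod_left_unit[of _ m])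
  have "unit_vec m i \<bullet> ((K * B) *\<^sub>v unit_vec m j) = unit_vec m i \<bullet> ((transpose_mat B * K) *\<^sub>v unit_vec m j)"
    using assms(1)[unfolded self_adjoint_def inner_mat_def, rule_format, of "unit_vec m i" "unit_vec m j"]
      assms(2) carriers scalar_prod_mult_mat_vec[of B m m "unit_vec m i" "K *\<^sub>v unit_vec m j"]
    by simp
  then show "(K * B) $$ (i, j) = (transpose_mat B * K) $$ (i, j)"
    using el[of "K * B"] el[of "transpose_mat B * K"] assms(2) carriers by (simp del: index_mult_mat)
qed (use assms carriers in auto)

text \<open>
  Two of the Penrose conditions already determine \<open>P\<close>. From \<open>K (A P) = (A P)\<^sup>T K\<close> one gets
  \<open>G P = A\<^sup>T K A P = (A P A)\<^sup>T K = A\<^sup>T K\<close>, the normal equation that the retraction satisfies as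
  well, and \<open>G\<close> can be cancelled.
\<close>

lemma pseudoinverse_unique:
  assumes "is_pseudoinverse n m G K A P"
  shows "P = retraction"
proof -
  have P: "P \<in> carrier_mat n m" "A * P * A = A" and sa: "self_adjoint m K (A * P)"
    using assms by (auto simp: is_pseudoinverse_def)
  obtain Gi where Gi: "mat_inverse G = Some Gi" "Gi \<in> carrier_mat n n" "G * Gi = 1\<^sub>m n" "Gi * G = 1\<^sub>m n"
    using sym_pos_def_inverse[OF pulled_back_sym_pos_def] .
  note R = retraction_carrier
  have AP: "A * P \<in> carrier_mat m m" using A P by simp
  have "G * P = transpose_mat A * (K * (A * P))"
    unfolding G using A P carriers
    by (simp add: assoc_mult_mat[of _ n m _ n _ m] assoc_mult_mat[of _ n m _ m _ n] assoc_mult_mat[of _ m m _ n _ m])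
  also have "\<dots> = (transpose_mat A * transpose_mat (A * P)) * K"
    using self_adjoint_transpose[OF sa AP] A AP carriers 
    by (simp add: assoc_mult_mat[of _ n m _ m _ m])
  also have "transpose_mat A * transpose_mat (A * P) = transpose_mat (A * P * A)"
    using AP A by (simp add: transpose_mult[of _ m m _ n])
  finally have "G * P = G * retraction" using P retraction_normal_equation by simp
  then have "Gi * (G * P) = Gi * (G * retraction)" by simp
  then show ?thesis using Gi P R carriers by (simp flip: assoc_mult_mat[of _ n n _ n _ m])
qed

lemma pseudoinverse_eq_retraction: "pseudoinverse n m G K A = retraction"
  unfolding pseudoinverse_def
  using is_pseudoinverse_retraction pseudoinverse_unique by (rule the_equality)

end

section \<open>Block vectors and the embedding\<close>

lemma block_diag_four_block:
  assumes "A \<in> carrier_mat m m" "B \<in> carrier_mat n n"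
  shows "block_diag A B = four_block_mat A (0\<^sub>m m n) (0\<^sub>m n m) B"
proof -
  have "block_diag A B = four_block_mat A (0\<^sub>m (dim_row A) (dim_col (diag_block_mat [B])))
      (0\<^sub>m (dim_row (diag_block_mat [B])) (dim_col A)) (diag_block_mat [B])"
    unfolding block_diag_def by (subst diag_block_mat.simps(2)) (simp only: Let_def)
  then show ?thesis unfolding diag_block_mat_singleton using assms by simp
qed

lemma block_diag_carrier:
  assumes "A \<in> carrier_mat m m" "B \<in> carrier_mat n n"
  shows "block_diag A B \<in> carrier_mat (m + n) (m + n)"
  using assms by (simp add: block_diag_four_block[OF assms])

lemma block_diag_mult_append:
  assumes "A \<in> carrier_mat m m" "B \<in> carrier_mat n n" "a \<in> carrier_vec m" "b \<in> carrier_vec n"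
  shows "block_diag A B *\<^sub>v (a @\<^sub>v b) = (A *\<^sub>v a) @\<^sub>v (B *\<^sub>v b)"
  unfolding block_diag_four_block[OF assms(1,2)] by (rule mult_mat_vec_split[OF assms])

lemma inner_mat_block_diag:
  assumes "H1 \<in> carrier_mat m m" "H2 \<in> carrier_mat n n"
    and "a \<in> carrier_vec m" "b \<in> carrier_vec n" "c \<in> carrier_vec m" "d \<in> carrier_vec n"
  shows "inner_mat (block_diag H1 H2) (a @\<^sub>v b) (c @\<^sub>v d) = inner_mat H1 a c + inner_mat H2 b d"
  unfolding inner_mat_def block_diag_mult_append[OF assms(1,2,5,6)]
  by (rule scalar_prod_append[OF assms(3,4)]) (use assms in auto)

lemma sym_pos_def_block_diag:
  assumes H1: "sym_pos_def m H1" and H2: "sym_pos_def n H2"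
  shows "sym_pos_def (m + n) (block_diag H1 H2)"
  unfolding sym_pos_def_def
proof (intro conjI ballI impI)
  note c = sym_pos_def_carrier[OF H1] sym_pos_def_carrier[OF H2]
  have T: "transpose_mat H1 = H1" "transpose_mat H2 = H2"
    using H1 H2 by (simp_all add: sym_pos_def_def)
  show "block_diag H1 H2 \<in> carrier_mat (m + n) (m + n)" by (rule block_diag_carrier[OF c])
  show "transpose_mat (block_diag H1 H2) = block_diag H1 H2"
    unfolding block_diag_four_block[OF c]
    using transpose_four_block_mat[OF c(1) zero_carrier_mat zero_carrier_mat c(2)] T by simp
  fix x :: "real vec" assume x: "x \<in> carrier_vec (m + n)" "x \<noteq> 0\<^sub>v (m + n)"
  define a b where "a = vec_first x m" and "b = vec_last x n"
  have ab: "a \<in> carrier_vec m" "b \<in> carrier_vec n" "x = a @\<^sub>v b"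
    using x by (simp_all add: a_def b_def)
  have "a \<noteq> 0\<^sub>v m \<or> b \<noteq> 0\<^sub>v n"
  proof (rule ccontr)
    assume "\<not> ?thesis"
    then have "x = 0\<^sub>v (m + n)" using ab by (intro eq_vecI) auto
    with x show False by simp
  qed
  then have "inner_mat H1 a a + inner_mat H2 b b > 0"
    using inner_mat_pos[OF H1 ab(1)] inner_mat_pos[OF H2 ab(2)]
      inner_mat_nonneg[OF H1 ab(1)] inner_mat_nonneg[OF H2 ab(2)] by fastforce
  then show "x \<bullet> (block_diag H1 H2 *\<^sub>v x) > 0"
    using inner_mat_block_diag[OF c ab(1,2) ab(1,2)] ab(3) by (simp add: inner_mat_def)
qed

text \<open>The two halves \<open>u\<^sup>(\<^sup>1\<^sup>)\<close> and \<open>u\<^sup>(\<^sup>2\<^sup>)\<close> of a multiblock vector; both contain the interface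
  entry \<open>u $ n1\<close>.\<close>

definition left_block :: "nat \<Rightarrow> 'a vec \<Rightarrow> 'a vec" where
  "left_block n1 u = vec (n1 + 1) (\<lambda>k. u $ k)"

definition right_block :: "nat \<Rightarrow> nat \<Rightarrow> 'a vec \<Rightarrow> 'a vec" where
  "right_block n1 n2 u = vec (n2 + 1) (\<lambda>k. u $ (n1 + k))"

lemma left_block_carrier [simp]: "left_block n1 u \<in> carrier_vec (n1 + 1)"
  and right_block_carrier [simp]: "right_block n1 n2 u \<in> carrier_vec (n2 + 1)"
  by (simp_all add: left_block_def right_block_def)

lemma embedding_carrier: "embedding n1 n2 \<in> carrier_mat ((n1 + 1) + (n2 + 1)) (n1 + n2 + 1)"
  by (simp add: embedding_def)

lemma embedding_mult:
  assumes u: "u \<in> carrier_vec (n1 + n2 + 1)"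
  shows "embedding n1 n2 *\<^sub>v u = left_block n1 u @\<^sub>v right_block n1 n2 u"
proof (rule eq_vecI)
  fix r assume "r < dim_vec (left_block n1 u @\<^sub>v right_block n1 n2 u)"
  then have r: "r < n1 + n2 + 2" by (simp add: left_block_def right_block_def)
  define s where "s = (if r \<le> n1 then r else r - 1)"
  have s: "s < n1 + n2 + 1" using r by (auto simp: s_def)
  have "row (embedding n1 n2) r = unit_vec (n1 + n2 + 1) s"
    using r s by (intro eq_vecI) (auto simp: embedding_def s_def)
  then have "(embedding n1 n2 *\<^sub>v u) $ r = u $ s"
    using r s u by (simp add: embedding_def scalar_prod_left_unit[of _ "n1 + n2 + 1"])
  also have "\<dots> = (left_block n1 u @\<^sub>v right_block n1 n2 u) $ r"
    using r by (auto simp: s_def left_block_def right_block_def)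
  finally show "(embedding n1 n2 *\<^sub>v u) $ r = (left_block n1 u @\<^sub>v right_block n1 n2 u) $ r" .
qed (simp add: embedding_def left_block_def right_block_def)

lemma embedding_injective:
  fixes u :: "real vec"
  assumes u: "u \<in> carrier_vec (n1 + n2 + 1)"
    and 0: "embedding n1 n2 *\<^sub>v u = 0\<^sub>v ((n1 + 1) + (n2 + 1))"
  shows "u = 0\<^sub>v (n1 + n2 + 1)"
proof (rule eq_vecI)
  fix k assume "k < dim_vec (0\<^sub>v (n1 + n2 + 1) :: real vec)"
  then have k: "k < n1 + n2 + 1" by simp
  define r where "r = (if k \<le> n1 then k else k + 1)"
  have "(embedding n1 n2 *\<^sub>v u) $ r = u $ k"
    using k by (auto simp: embedding_mult[OF u] r_def left_block_def right_block_def)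
  then show "u $ k = 0\<^sub>v (n1 + n2 + 1) $ k" using 0 k by (simp add: r_def)
qed (use u in simp)

text \<open>A pair of block vectors comes from one multiblock vector as soon as the two interface values
  agree. These pairs are the test vectors in the orthogonality relation of the residual.\<close>

lemma embedding_range:
  assumes a: "a \<in> carrier_vec (n1 + 1)" and b: "b \<in> carrier_vec (n2 + 1)"
    and interface: "a $ n1 = b $ 0"
  obtains v where "v \<in> carrier_vec (n1 + n2 + 1)" "embedding n1 n2 *\<^sub>v v = a @\<^sub>v b"
proof -
  define v where "v = vec (n1 + n2 + 1) (\<lambda>k. if k \<le> n1 then a $ k else b $ (k - n1))"
  have v: "v \<in> carrier_vec (n1 + n2 + 1)" by (simp add: v_def)
  have "left_block n1 v = a" using a by (intro eq_vecI) (auto simp: left_block_def v_def)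
  moreover have "right_block n1 n2 v = b"
    using b interface by (intro eq_vecI) (auto simp: right_block_def v_def)
  ultimately show ?thesis using that[OF v] embedding_mult[OF v] by simp
qed

section \<open>The multiblock operator\<close>

locale multiblock =
  fixes n1 n2 :: nat and H1 H2 D1 D2 :: "real mat"
  assumes H1: "sym_pos_def (n1 + 1) H1" and H2: "sym_pos_def (n2 + 1) H2"
    and D1: "D1 \<in> carrier_mat (n1 + 1) (n1 + 1)" and D2: "D2 \<in> carrier_mat (n2 + 1) (n2 + 1)"
begin

sublocale isometric_embedding "(n1 + 1) + (n2 + 1)" "n1 + n2 + 1"
  "block_diag H1 H2" "embedding n1 n2" "multiblock_norm n1 n2 H1 H2"
  by unfold_locales
    (rule sym_pos_def_block_diag[OF H1 H2] embedding_carrier embedding_injective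
      multiblock_norm_def | assumption)+

lemmas block_carriers = sym_pos_def_carrier[OF H1] sym_pos_def_carrier[OF H2]

abbreviation diff :: "real mat" where
  "diff \<equiv> multiblock_diff n1 n2 H1 H2 D1 D2"

lemma diff_eq_retraction: "diff = retraction * block_diag D1 D2 * embedding n1 n2"
  by (simp add: multiblock_diff_def retraction_def)

lemma diff_mult:
  assumes u: "u \<in> carrier_vec (n1 + n2 + 1)"
  shows "diff *\<^sub>v u = retraction *\<^sub>v ((D1 *\<^sub>v left_block n1 u) @\<^sub>v (D2 *\<^sub>v right_block n1 n2 u))"
proof -
  have Eu: "embedding n1 n2 *\<^sub>v u \<in> carrier_vec ((n1 + 1) + (n2 + 1))"
    using embedding_carrier u by (rule mult_mat_vec_carrier)
  note DB = block_diag_carrier[OF D1 D2]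
  have "diff *\<^sub>v u = (retraction * block_diag D1 D2) *\<^sub>v (embedding n1 n2 *\<^sub>v u)"
    unfolding diff_eq_retraction
    by (rule assoc_mult_mat_vec[OF mult_carrier_mat[OF retraction_carrier DB] embedding_carrier u])
  also have "\<dots> = retraction *\<^sub>v (block_diag D1 D2 *\<^sub>v (embedding n1 n2 *\<^sub>v u))"
    by (rule assoc_mult_mat_vec[OF retraction_carrier DB Eu])
  finally show ?thesis
    by (simp only: embedding_mult[OF u] block_diag_mult_append[OF D1 D2 left_block_carrier right_block_carrier])
qed

text \<open>
  Adjointness of the retraction splits \<open>(u, D v)\<close> into the two block inner products. Each block
  satisfies summation by parts, and the boundary terms at the interface cancel because both
  blocks carry the same value there.
\<close>

lemma summation_by_parts_diff:
  assumes sbp1: "summation_by_parts n1 H1 D1" and sbp2: "summation_by_parts n2 H2 D2"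
  shows "summation_by_parts (n1 + n2) (multiblock_norm n1 n2 H1 H2) diff"
  unfolding summation_by_parts_def
proof (intro ballI)
  have key: "inner_mat (multiblock_norm n1 n2 H1 H2) u (diff *\<^sub>v v) =
      inner_mat H1 (left_block n1 u) (D1 *\<^sub>v left_block n1 v) +
      inner_mat H2 (right_block n1 n2 u) (D2 *\<^sub>v right_block n1 n2 v)"
    if u: "u \<in> carrier_vec (n1 + n2 + 1)" and v: "v \<in> carrier_vec (n1 + n2 + 1)" for u v
  proof -
    have Dv: "D1 *\<^sub>v left_block n1 v \<in> carrier_vec (n1 + 1)"
      "D2 *\<^sub>v right_block n1 n2 v \<in> carrier_vec (n2 + 1)"
      by (rule mult_mat_vec_carrier[OF D1 left_block_carrier] mult_mat_vec_carrier[OF D2 right_block_carrier])+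
    show ?thesis
      unfolding diff_mult[OF v] inner_mat_retraction[OF u append_carrier_vec[OF Dv]] embedding_mult[OF u]
      by (rule inner_mat_block_diag[OF block_carriers left_block_carrier right_block_carrier Dv])
  qed
  fix u v :: "real vec"
  assume u: "u \<in> carrier_vec (n1 + n2 + 1)" and v: "v \<in> carrier_vec (n1 + n2 + 1)"
  have Du: "D1 *\<^sub>v left_block n1 u \<in> carrier_vec (n1 + 1)"
    "D2 *\<^sub>v right_block n1 n2 u \<in> carrier_vec (n2 + 1)"
    by (rule mult_mat_vec_carrier[OF D1 left_block_carrier] mult_mat_vec_carrier[OF D2 right_block_carrier])+
  have "diff *\<^sub>v u \<in> carrier_vec (n1 + n2 + 1)"
    unfolding diff_mult[OF u]
    by (rule mult_mat_vec_carrier[OF retraction_carrier append_carrier_vec[OF Du]])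
  then have "inner_mat (multiblock_norm n1 n2 H1 H2) (diff *\<^sub>v u) v =
      inner_mat H1 (left_block n1 v) (D1 *\<^sub>v left_block n1 u) +
      inner_mat H2 (right_block n1 n2 v) (D2 *\<^sub>v right_block n1 n2 u)"
    using inner_mat_commute[OF pulled_back_sym_pos_def _ v] key[OF v u] by simp
  moreover have "inner_mat H1 (left_block n1 v) (D1 *\<^sub>v left_block n1 u)
      = inner_mat H1 (D1 *\<^sub>v left_block n1 u) (left_block n1 v)"
    "inner_mat H2 (right_block n1 n2 v) (D2 *\<^sub>v right_block n1 n2 u)
      = inner_mat H2 (D2 *\<^sub>v right_block n1 n2 u) (right_block n1 n2 v)"
    by (rule inner_mat_commute[OF H1 left_block_carrier Du(1)]
        inner_mat_commute[OF H2 right_block_carrier Du(2)])+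
  moreover have "inner_mat H1 (left_block n1 u) (D1 *\<^sub>v left_block n1 v) =
      u $ n1 * v $ n1 - u $ 0 * v $ 0 - inner_mat H1 (D1 *\<^sub>v left_block n1 u) (left_block n1 v)"
    using sbp1 left_block_carrier[of n1 u] left_block_carrier[of n1 v]
    unfolding summation_by_parts_def by (fastforce simp: left_block_def)
  moreover have "inner_mat H2 (right_block n1 n2 u) (D2 *\<^sub>v right_block n1 n2 v) =
      u $ (n1 + n2) * v $ (n1 + n2) - u $ n1 * v $ n1
      - inner_mat H2 (D2 *\<^sub>v right_block n1 n2 u) (right_block n1 n2 v)"
    using sbp2 right_block_carrier[of n1 n2 u] right_block_carrier[of n1 n2 v]
    unfolding summation_by_parts_def by (fastforce simp: right_block_def)
  ultimately show "inner_mat (multiblock_norm n1 n2 H1 H2) u (diff *\<^sub>v v) =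
      u $ (n1 + n2) * v $ (n1 + n2) - u $ 0 * v $ 0
      - inner_mat (multiblock_norm n1 n2 H1 H2) (diff *\<^sub>v u) v"
    using key[OF u v] by simp
qed

text \<open>The multiblock norm is the pulled back inner product, so the multiblock operator contains
  the pseudoinverse literally.\<close>

lemma diff_eq_pseudoinverse:
  "diff = pseudoinverse (n1 + n2 + 1) (n1 + n2 + 2) (multiblock_norm n1 n2 H1 H2)
     (block_diag H1 H2) (embedding n1 n2) * block_diag D1 D2 * embedding n1 n2"
proof -
  have "n1 + n2 + 2 = (n1 + 1) + (n2 + 1)" by simp
  then show ?thesis by (simp only: pseudoinverse_eq_retraction diff_eq_retraction)
qed

end

section \<open>Stability of the pseudoinverse\<close>

text \<open>The retraction is a contraction in the weighted norms; the triangle inequality for the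
  Euclidean norm of the pair of block norms gives the sum.\<close>

lemma (in multiblock) inner_norm_retraction_le:
  assumes a: "a \<in> carrier_vec (n1 + 1)" and b: "b \<in> carrier_vec (n2 + 1)"
  shows "inner_norm (multiblock_norm n1 n2 H1 H2) (retraction *\<^sub>v (a @\<^sub>v b))
    \<le> inner_norm H1 a + inner_norm H2 b"
proof -
  have "inner_norm (multiblock_norm n1 n2 H1 H2) (retraction *\<^sub>v (a @\<^sub>v b))
      \<le> sqrt (inner_mat H1 a a + inner_mat H2 b b)"
    unfolding inner_norm_def inner_mat_block_diag[OF block_carriers a b a b, symmetric]
    by (rule real_sqrt_le_mono, rule retraction_contraction, rule append_carrier_vec[OF a b])
  also have "\<dots> \<le> inner_norm H1 a + inner_norm H2 b"
    unfolding inner_norm_def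
    by (rule sqrt_add_le_add_sqrt) (rule inner_mat_nonneg[OF H1 a] inner_mat_nonneg[OF H2 b])+
  finally show ?thesis .
qed

text \<open>
  The hypothesis \<open>concentrated\<close> holds when \<open>H r\<close> is a multiple \<open>\<mu>\<close> of the \<open>k\<close>-th unit vector.
  Then \<open>(r, r) = r\<^sub>k \<mu>\<close>, while Cauchy-Schwarz bounds \<open>\<mu>\<^sup>2\<close> by \<open>C h (r, r)\<close>; together these give
  \<open>\<bar>\<mu>\<bar> \<le> C h \<bar>r\<^sub>k\<bar>\<close> and hence \<open>(r, r) \<le> C h r\<^sub>k\<^sup>2\<close>. The factor \<open>h\<close> cancels against the lower bound
  \<open>c h r\<^sub>i\<^sup>2 \<le> (r, r)\<close>, so a single entry controls all others uniformly in the mesh size.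
\<close>

lemma concentrated_residual_bound:
  assumes H: "sym_pos_def n H" and k: "k < n" and r: "r \<in> carrier_vec n" and i: "i < n"
    and c: "c > 0" and h: "h > 0"
    and lower: "c * (h * (r \<bullet> r)) \<le> inner_mat H r r"
    and upper: "inner_mat H (unit_vec n k) (unit_vec n k) \<le> C * h"
    and concentrated: "inner_mat H r r = r $ k * inner_mat H (unit_vec n k) r"
  shows "\<bar>r $ i\<bar> \<le> sqrt (C / c) * \<bar>r $ k\<bar>"
proof -
  define \<mu> where "\<mu> = inner_mat H (unit_vec n k) r"
  have e: "unit_vec n k \<in> carrier_vec n" "unit_vec n k \<noteq> (0\<^sub>v n :: real vec)"
    using k by (auto dest: arg_cong[of _ _ "\<lambda>v. v $ k"])
  have Ch: "C * h > 0" using inner_mat_pos[OF H e] upper by linarith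
  have rr: "inner_mat H r r \<le> \<bar>r $ k\<bar> * \<bar>\<mu>\<bar>"
    unfolding concentrated \<mu>_def[symmetric] by (simp flip: abs_mult)
  have "\<bar>\<mu>\<bar> * \<bar>\<mu>\<bar> \<le> inner_mat H (unit_vec n k) (unit_vec n k) * inner_mat H r r"
    using inner_mat_Cauchy_Schwarz[OF H e(1) r] by (simp add: \<mu>_def power2_eq_square)
  also have "\<dots> \<le> (C * h) * (\<bar>r $ k\<bar> * \<bar>\<mu>\<bar>)"
    using upper rr Ch inner_mat_nonneg[OF H r] by (intro mult_mono) auto
  finally have "\<bar>\<mu>\<bar> * \<bar>\<mu>\<bar> \<le> C * h * (\<bar>r $ k\<bar> * \<bar>\<mu>\<bar>)" .
  then have lam: "\<bar>\<mu>\<bar> \<le> C * h * \<bar>r $ k\<bar>"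
  proof (cases "\<mu> = 0")
    case False
    with \<open>\<bar>\<mu>\<bar> * \<bar>\<mu>\<bar> \<le> C * h * (\<bar>r $ k\<bar> * \<bar>\<mu>\<bar>)\<close> show ?thesis
      by (intro mult_right_le_imp_le[of "\<bar>\<mu>\<bar>" "\<bar>\<mu>\<bar>"]) (auto simp: mult.assoc)
  qed (use Ch in simp)
  have ri: "(r $ i)\<^sup>2 \<le> r \<bullet> r"
  proof -
    have "(r $ i)\<^sup>2 \<le> (\<Sum>j\<in>{0..<n}. (r $ j)\<^sup>2)" using i by (intro member_le_sum) auto
    then show ?thesis using r by (simp add: scalar_prod_def power2_eq_square)
  qed
  have "c * h * (r $ i)\<^sup>2 \<le> c * (h * (r \<bullet> r))"
    using c h ri by (simp add: mult.assoc)
  also have "\<dots> \<le> \<bar>r $ k\<bar> * \<bar>\<mu>\<bar>" using lower rr by linarith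
  also have "\<dots> \<le> \<bar>r $ k\<bar> * (C * h * \<bar>r $ k\<bar>)" using lam by (intro mult_left_mono) auto
  also have "\<dots> = C * h * (r $ k)\<^sup>2" by (simp add: power2_eq_square)
  finally have "(r $ i)\<^sup>2 \<le> (C / c) * (r $ k)\<^sup>2"
    using c h by (simp add: field_simps)
  then have "sqrt ((r $ i)\<^sup>2) \<le> sqrt ((C / c) * (r $ k)\<^sup>2)" by (rule real_sqrt_le_mono)
  then show ?thesis unfolding real_sqrt_mult by simp
qed

lemma max_norm_ge: "k < dim_vec v \<Longrightarrow> \<bar>v $ k\<bar> \<le> max_norm v"
  unfolding max_norm_def by (intro Max_ge) auto

lemma max_norm_nonneg:
  assumes "v \<in> carrier_vec (n + 1)"
  shows "max_norm v \<ge> 0"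
  using max_norm_ge[of 0 v] assms by auto

lemma max_norm_le:
  assumes "dim_vec v > 0" "\<And>k. k < dim_vec v \<Longrightarrow> \<bar>v $ k\<bar> \<le> B"
  shows "max_norm v \<le> B"
  unfolding max_norm_def using assms by (subst Max_le_iff) auto

context multiblock begin

text \<open>
  A vector orthogonal to all continuous pairs is a reaction to the jump constraint at the
  interface: \<open>H1 r1\<close> and \<open>H2 r2\<close> are opposite multiples of the interface unit vectors. The
  multipliers are the inner products with these unit vectors, and the three equations are all
  that the estimates need of this structure.
\<close>

lemma interface_residual:
  assumes r1: "r1 \<in> carrier_vec (n1 + 1)" and r2: "r2 \<in> carrier_vec (n2 + 1)"
    and orth: "\<And>v. v \<in> carrier_vec (n1 + n2 + 1) \<Longrightarrow>
      inner_mat (block_diag H1 H2) (embedding n1 n2 *\<^sub>v v) (r1 @\<^sub>v r2) = 0"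
  shows "inner_mat H1 r1 r1 = r1 $ n1 * inner_mat H1 (unit_vec (n1 + 1) n1) r1"
    and "inner_mat H2 r2 r2 = r2 $ 0 * inner_mat H2 (unit_vec (n2 + 1) 0) r2"
    and "inner_mat H1 (unit_vec (n1 + 1) n1) r1 + inner_mat H2 (unit_vec (n2 + 1) 0) r2 = 0"
proof -
  let ?d1 = "unit_vec (n1 + 1) n1 :: real vec" and ?d2 = "unit_vec (n2 + 1) 0 :: real vec"
  have d: "?d1 \<in> carrier_vec (n1 + 1)" "?d2 \<in> carrier_vec (n2 + 1)" by auto
  have orth': "inner_mat H1 a r1 + inner_mat H2 b r2 = 0"
    if a: "a \<in> carrier_vec (n1 + 1)" and b: "b \<in> carrier_vec (n2 + 1)" and ab: "a $ n1 = b $ 0" for a b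
  proof -
    obtain v where "v \<in> carrier_vec (n1 + n2 + 1)" "embedding n1 n2 *\<^sub>v v = a @\<^sub>v b"
      using embedding_range[OF a b ab] .
    then show ?thesis using orth[of v] inner_mat_block_diag[OF block_carriers a b r1 r2] by simp
  qed
  \<comment> \<open>The test pairs are the interface unit vectors, \<open>r1\<close> continued into block 2 by its interface
    value, and \<open>r2\<close> continued into block 1 in the same way.\<close>
  show sum0: "inner_mat H1 ?d1 r1 + inner_mat H2 ?d2 r2 = 0"
    by (rule orth'[OF d]) simp
  have eq: "inner_mat H1 r1 r1 + inner_mat H2 (r1 $ n1 \<cdot>\<^sub>v ?d2) r2 = 0"
    by (rule orth'[OF r1]) auto
  have eq2: "inner_mat H1 (r2 $ 0 \<cdot>\<^sub>v ?d1) r1 + inner_mat H2 r2 r2 = 0"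
    by (rule orth'[OF _ r2]) auto
  have "inner_mat H1 r1 r1 = - (r1 $ n1 * inner_mat H2 ?d2 r2)"
    using eq inner_mat_smult_left[OF block_carriers(2) d(2) r2] by simp
  moreover have "inner_mat H2 ?d2 r2 = - inner_mat H1 ?d1 r1" using sum0 by linarith
  ultimately show "inner_mat H1 r1 r1 = r1 $ n1 * inner_mat H1 ?d1 r1" by simp
  have "inner_mat H2 r2 r2 = - (r2 $ 0 * inner_mat H1 ?d1 r1)"
    using eq2 inner_mat_smult_left[OF block_carriers(1) d(1) r1] by simp
  moreover have "inner_mat H1 ?d1 r1 = - inner_mat H2 ?d2 r2" using sum0 by linarith
  ultimately show "inner_mat H2 r2 r2 = r2 $ 0 * inner_mat H2 ?d2 r2" by simp
qed

text \<open>
  The projection moves the pair \<open>(a, b)\<close> by the residual \<open>(r1, r2)\<close>, so it suffices to bound the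
  residual by the jump \<open>a $ n1 - b $ 0\<close>. By the concentration estimate only its two interface
  entries matter. These have opposite signs, and their difference is the jump; hence neither
  exceeds the jump in absolute value.
\<close>

lemma max_norm_retraction_le:
  assumes a: "a \<in> carrier_vec (n1 + 1)" and b: "b \<in> carrier_vec (n2 + 1)"
    and n: "n1 \<ge> 1" "n2 \<ge> 1" and c: "c1 > 0" "c2 > 0"
    and eqv1: "\<And>x. x \<in> carrier_vec (n1 + 1) \<Longrightarrow> c1 * (mesh_size n1 * (x \<bullet> x)) \<le> inner_mat H1 x x \<and>
      inner_mat H1 x x \<le> C1 * (mesh_size n1 * (x \<bullet> x))"
    and eqv2: "\<And>x. x \<in> carrier_vec (n2 + 1) \<Longrightarrow> c2 * (mesh_size n2 * (x \<bullet> x)) \<le> inner_mat H2 x x \<and>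
      inner_mat H2 x x \<le> C2 * (mesh_size n2 * (x \<bullet> x))"
  shows "max_norm (retraction *\<^sub>v (a @\<^sub>v b))
    \<le> (1 + max (sqrt (C1 / c1)) (sqrt (C2 / c2))) * (max_norm a + max_norm b)"
proof -
  let ?d1 = "unit_vec (n1 + 1) n1 :: real vec" and ?d2 = "unit_vec (n2 + 1) 0 :: real vec"
  define K where "K = max (sqrt (C1 / c1)) (sqrt (C2 / c2))"
  define M where "M = max_norm a + max_norm b"
  define e where "e = retraction *\<^sub>v (a @\<^sub>v b)"
  define r1 where "r1 = a - left_block n1 e"
  define r2 where "r2 = b - right_block n1 n2 e"
  have h: "mesh_size n1 > 0" "mesh_size n2 > 0" using n by (auto simp: mesh_size_def)
  note ab = append_carrier_vec[OF a b]
  have e: "e \<in> carrier_vec (n1 + n2 + 1)"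
    unfolding e_def by (rule mult_mat_vec_carrier[OF retraction_carrier ab])
  have r: "r1 \<in> carrier_vec (n1 + 1)" "r2 \<in> carrier_vec (n2 + 1)"
    unfolding r1_def r2_def
    by (rule minus_carrier_vec[OF a left_block_carrier] minus_carrier_vec[OF b right_block_carrier])+
  have sum: "left_block n1 e + r1 = a" "right_block n1 n2 e + r2 = b"
    using a b by (auto intro!: eq_vecI simp: r1_def r2_def left_block_def right_block_def)
  have dec: "a @\<^sub>v b = embedding n1 n2 *\<^sub>v (retraction *\<^sub>v (a @\<^sub>v b)) + (r1 @\<^sub>v r2)"
    unfolding e_def[symmetric] embedding_mult[OF e]
      append_vec_add[OF left_block_carrier r(1) right_block_carrier r(2)] sum ..
  note res = interface_residual[OF r residual_orthogonal[OF _ ab append_carrier_vec[OF r] dec]]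
  have d: "?d1 \<in> carrier_vec (n1 + 1)" "?d2 \<in> carrier_vec (n2 + 1)" by auto
  have b1: "\<bar>r1 $ i\<bar> \<le> sqrt (C1 / c1) * \<bar>r1 $ n1\<bar>" if "i < n1 + 1" for i
    using concentrated_residual_bound[OF H1 _ r(1) that c(1) h(1) _ _ res(1), of C1]
      eqv1[OF r(1)] eqv1[OF d(1)] by simp
  have b2: "\<bar>r2 $ i\<bar> \<le> sqrt (C2 / c2) * \<bar>r2 $ 0\<bar>" if "i < n2 + 1" for i
    using concentrated_residual_bound[OF H2 _ r(2) that c(2) h(2) _ _ res(2), of C2]
      eqv2[OF r(2)] eqv2[OF d(2)] by simp
  have jump: "r1 $ n1 - r2 $ 0 = a $ n1 - b $ 0"
    using a b by (simp add: r1_def r2_def left_block_def right_block_def)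
  have M0: "\<bar>a $ k\<bar> \<le> M" if "k < n1 + 1" for k
    using max_norm_ge[of k a] max_norm_ge[of 0 b] a b that by (auto simp: M_def)
  have M1: "\<bar>b $ k\<bar> \<le> M" if "k < n2 + 1" for k
    using max_norm_ge[of k b] max_norm_ge[of 0 a] a b that by (auto simp: M_def)
  have jumpM: "\<bar>r1 $ n1 - r2 $ 0\<bar> \<le> M"
    unfolding jump M_def using max_norm_ge[of n1 a] max_norm_ge[of 0 b] a b by auto
  have "\<bar>r1 $ n1\<bar> \<le> M \<and> \<bar>r2 $ 0\<bar> \<le> M"
  proof -
    \<comment> \<open>The squared norms \<open>r1 $ n1 * \<mu>\<close> and \<open>- r2 $ 0 * \<mu>\<close> are nonnegative, which forces opposite
      signs unless \<open>\<mu>\<close> vanishes, and then both residuals are zero.\<close>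
    define \<mu> where "\<mu> = inner_mat H1 ?d1 r1"
    have s1: "r1 $ n1 * \<mu> \<ge> 0"
      using res(1) inner_mat_nonneg[OF H1 r(1)] by (simp add: \<mu>_def)
    have "inner_mat H2 ?d2 r2 = - \<mu>" using res(3) by (simp add: \<mu>_def)
    then have s2: "inner_mat H2 r2 r2 = - (r2 $ 0 * \<mu>)" using res(2) by simp
    then have s2': "r2 $ 0 * \<mu> \<le> 0" using inner_mat_nonneg[OF H2 r(2)] by simp
    consider "\<mu> > 0" | "\<mu> < 0" | "\<mu> = 0" by linarith
    then show ?thesis
    proof cases
      case 1
      then have "r1 $ n1 \<ge> 0" "r2 $ 0 \<le> 0" using s1 s2' by (auto simp: zero_le_mult_iff mult_le_0_iff)
      then show ?thesis using jumpM by linarith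
    next
      case 2
      then have "r1 $ n1 \<le> 0" "r2 $ 0 \<ge> 0" using s1 s2' by (auto simp: zero_le_mult_iff mult_le_0_iff)
      then show ?thesis using jumpM by linarith
    next
      case 3
      then have "r1 = 0\<^sub>v (n1 + 1)" "r2 = 0\<^sub>v (n2 + 1)"
        using res(1) s2 inner_mat_pos[OF H1 r(1)] inner_mat_pos[OF H2 r(2)] by (auto simp: \<mu>_def)
      then show ?thesis using jumpM by simp
    qed
  qed
  moreover have "sqrt (C1 / c1) * \<bar>r1 $ n1\<bar> \<le> K * \<bar>r1 $ n1\<bar>" "sqrt (C2 / c2) * \<bar>r2 $ 0\<bar> \<le> K * \<bar>r2 $ 0\<bar>"
    by (intro mult_right_mono; simp add: K_def)+
  moreover have K0: "K \<ge> 0"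
  proof -
    have "C1 * mesh_size n1 > 0"
      using eqv1[OF d(1)] inner_mat_pos[OF H1 d(1)] by (auto dest: arg_cong[of _ _ "\<lambda>v. v $ n1"])
    then have "C1 > 0" using h by (simp add: zero_less_mult_iff)
    then show ?thesis using c by (simp add: K_def le_max_iff_disj)
  qed
  ultimately have KM: "sqrt (C1 / c1) * \<bar>r1 $ n1\<bar> \<le> K * M" "sqrt (C2 / c2) * \<bar>r2 $ 0\<bar> \<le> K * M"
    by (meson mult_left_mono order_trans)+
  have "max_norm e \<le> (1 + K) * M"
  proof (rule max_norm_le)
    show "dim_vec e > 0" using e by simp
    fix k assume "k < dim_vec e"
    then have k: "k < n1 + n2 + 1" using e by simp
    show "\<bar>e $ k\<bar> \<le> (1 + K) * M"
    proof (cases "k \<le> n1")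
      case True
      then have "e $ k = a $ k - r1 $ k" using a by (simp add: r1_def left_block_def)
      then show ?thesis using M0[of k] b1[of k] KM True by (auto simp: algebra_simps)
    next
      case False
      then have "e $ k = b $ (k - n1) - r2 $ (k - n1)" using b k by (simp add: r2_def right_block_def)
      moreover have "k - n1 < n2 + 1" using k by simp
      note M1[OF this] b2[OF this]
      ultimately show ?thesis using KM distrib_right[of 1 K M] by linarith
    qed
  qed
  then show ?thesis by (simp add: e_def K_def M_def)
qed

end

section \<open>Consistency\<close>

lemma smooth_on_subset:
  assumes "smooth_on T u" "S \<subseteq> T"
  shows "smooth_on S u"
proof -
  obtain g where g: "g 0 = u" "\<And>k t. t \<in> T \<Longrightarrow> (g k has_real_derivative g (Suc k) t) (at t within T)"
    using assms(1) unfolding smooth_on_def by blast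
  have "(g k has_real_derivative g (Suc k) t) (at t within S)" if "t \<in> S" for k t
    using has_field_derivative_subset[OF g(2) assms(2)] that assms(2) by blast
  with g(1) show ?thesis unfolding smooth_on_def by blast
qed

lemma left_block_grid:
  "left_block n1 (map_vec u (multiblock_grid n1 n2)) = map_vec u (uniform_grid 0 n1)"
  by (intro eq_vecI) (auto simp: left_block_def multiblock_grid_def uniform_grid_def)

lemma right_block_grid:
  assumes "n1 \<ge> 1"
  shows "right_block n1 n2 (map_vec u (multiblock_grid n1 n2)) = map_vec u (uniform_grid (1/2) n2)"
proof (rule eq_vecI)
  fix k assume "k < dim_vec (map_vec u (uniform_grid (1/2) n2))"
  moreover have "u (real n1 * mesh_size n1) = u (1/2)" using assms by (simp add: mesh_size_def)
  ultimately show "right_block n1 n2 (map_vec u (multiblock_grid n1 n2)) $ k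
      = map_vec u (uniform_grid (1/2) n2) $ k"
    by (cases "k = 0") (auto simp: right_block_def multiblock_grid_def uniform_grid_def)
qed (simp add: right_block_def uniform_grid_def)

text \<open>
  The embedded grid function restricts to the block grids exactly, and the retraction inverts the
  embedding, so the multiblock truncation error is the retraction of the pair of block
  truncation errors.
\<close>

lemma (in multiblock) truncation_error:
  assumes "n1 \<ge> 1"
  shows "diff *\<^sub>v map_vec u (multiblock_grid n1 n2) - map_vec u' (multiblock_grid n1 n2) =
    retraction *\<^sub>v
      ((D1 *\<^sub>v map_vec u (uniform_grid 0 n1) - map_vec u' (uniform_grid 0 n1)) @\<^sub>v
       (D2 *\<^sub>v map_vec u (uniform_grid (1/2) n2) - map_vec u' (uniform_grid (1/2) n2)))"
proof -
  let ?g = "map_vec u (multiblock_grid n1 n2)" and ?g' = "map_vec u' (multiblock_grid n1 n2)"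
  let ?D1 = "D1 *\<^sub>v left_block n1 ?g" and ?D2 = "D2 *\<^sub>v right_block n1 n2 ?g"
  have g: "?g \<in> carrier_vec (n1 + n2 + 1)" "?g' \<in> carrier_vec (n1 + n2 + 1)"
    by (simp_all add: multiblock_grid_def)
  have D: "?D1 \<in> carrier_vec (n1 + 1)" "?D2 \<in> carrier_vec (n2 + 1)"
    by (rule mult_mat_vec_carrier[OF D1 left_block_carrier] mult_mat_vec_carrier[OF D2 right_block_carrier])+
  have "?g' = retraction *\<^sub>v (embedding n1 n2 *\<^sub>v ?g')"
    using assoc_mult_mat_vec[OF retraction_carrier embedding_carrier g(2)] retraction_left_inverse g(2)
    by simp
  then have "?g' = retraction *\<^sub>v (left_block n1 ?g' @\<^sub>v right_block n1 n2 ?g')"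
    unfolding embedding_mult[OF g(2)] .
  then have "diff *\<^sub>v ?g - ?g' = retraction *\<^sub>v (?D1 @\<^sub>v ?D2)
      - retraction *\<^sub>v (left_block n1 ?g' @\<^sub>v right_block n1 n2 ?g')"
    using diff_mult[OF g(1)] by simp
  also have "\<dots> = retraction *\<^sub>v ((?D1 @\<^sub>v ?D2) - (left_block n1 ?g' @\<^sub>v right_block n1 n2 ?g'))"
    by (rule mult_minus_distrib_mat_vec[symmetric, OF retraction_carrier append_carrier_vec[OF D]
        append_carrier_vec[OF left_block_carrier right_block_carrier]])
  also have "(?D1 @\<^sub>v ?D2) - (left_block n1 ?g' @\<^sub>v right_block n1 n2 ?g')
      = (?D1 - left_block n1 ?g') @\<^sub>v (?D2 - right_block n1 n2 ?g')"
    using D1 D2 by (intro eq_vecI) (auto simp: left_block_def right_block_def)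
  finally show ?thesis unfolding left_block_grid right_block_grid[OF assms] .
qed

text \<open>Lowering the order enlarges \<open>g j powr p\<close> only because mesh sizes do not exceed 1; enlarging
  the mesh size enlarges the power because the order is nonnegative.\<close>

lemma bigo_powr_weaken:
  fixes g h :: "'a \<Rightarrow> real"
  assumes f: "f \<in> O[F](\<lambda>j. g j powr p)" and q: "0 \<le> q" "q \<le> p"
    and g: "\<And>j. 0 \<le> g j" "\<And>j. g j \<le> 1" "\<And>j. g j \<le> h j"
  shows "f \<in> O[F](\<lambda>j. h j powr q)"
proof -
  have "g j powr p \<le> h j powr q" for j
  proof -
    have "g j powr p \<le> g j powr q" using q g by (intro powr_mono') auto
    also have "\<dots> \<le> h j powr q" using q g by (intro powr_mono2) auto
    finally show ?thesis .
  qed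
  then have "(\<lambda>j. g j powr p) \<in> O[F](\<lambda>j. h j powr q)"
    by (intro bigoI[of _ 1] always_eventually) auto
  with f show ?thesis by (rule landau_o.big_trans)
qed

lemma mesh_size_bounds:
  assumes "n \<ge> 1"
  shows "0 \<le> mesh_size n" "mesh_size n \<le> 1"
  using assms by (auto simp: mesh_size_def field_simps)

text \<open>
  Lax-type transfer: in any family of norms in which the retractions are bounded uniformly in the
  refinement level, consistency of the blocks passes to the multiblock operator. The lower of the
  two orders survives, measured in the larger mesh size.
\<close>

lemma multiblock_consistent:
  fixes N1 N2 :: "nat \<Rightarrow> nat" and H1 H2 D1 D2 :: "nat \<Rightarrow> real mat"
  assumes mb: "\<And>j. multiblock (N1 j) (N2 j) (H1 j) (H2 j) (D1 j) (D2 j)"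
    and N: "\<And>j. N1 j \<ge> 1" "\<And>j. N2 j \<ge> 1"
    and stable: "\<And>j a b. a \<in> carrier_vec (N1 j + 1) \<Longrightarrow> b \<in> carrier_vec (N2 j + 1) \<Longrightarrow>
      \<bar>nrm j (isometric_embedding.retraction (block_diag (H1 j) (H2 j)) (embedding (N1 j) (N2 j))
          (multiblock_norm (N1 j) (N2 j) (H1 j) (H2 j)) *\<^sub>v (a @\<^sub>v b))\<bar>
        \<le> B * (\<bar>nrm1 j a\<bar> + \<bar>nrm2 j b\<bar>)"
    and p: "p1 > 0" "p2 > 0"
    and con1: "consistent_of_order nrm1 {0..1/2} (\<lambda>j. uniform_grid 0 (N1 j)) (\<lambda>j. mesh_size (N1 j)) D1 p1"
    and con2: "consistent_of_order nrm2 {1/2..1} (\<lambda>j. uniform_grid (1/2) (N2 j)) (\<lambda>j. mesh_size (N2 j)) D2 p2"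
  shows "consistent_of_order nrm {0..1} (\<lambda>j. multiblock_grid (N1 j) (N2 j))
    (\<lambda>j. max (mesh_size (N1 j)) (mesh_size (N2 j)))
    (\<lambda>j. multiblock_diff (N1 j) (N2 j) (H1 j) (H2 j) (D1 j) (D2 j)) (min p1 p2)"
  unfolding consistent_of_order_def
proof (intro allI impI)
  fix u u' :: "real \<Rightarrow> real"
  assume "smooth_on {0..1} u \<and> (\<forall>t\<in>{0..1}. (u has_real_derivative u' t) (at t within {0..1}))"
  then have u: "smooth_on {0..1} u" "\<And>t. t \<in> {0..1} \<Longrightarrow> (u has_real_derivative u' t) (at t within {0..1})"
    by auto
  have restrict: "smooth_on S u \<and> (\<forall>t\<in>S. (u has_real_derivative u' t) (at t within S))"
    if "S \<subseteq> {0..1}" for S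
    using smooth_on_subset[OF u(1) that] u(2) that by (meson has_field_derivative_subset subsetD)
  define e1 where "e1 j = D1 j *\<^sub>v map_vec u (uniform_grid 0 (N1 j)) - map_vec u' (uniform_grid 0 (N1 j))" for j
  define e2 where "e2 j = D2 j *\<^sub>v map_vec u (uniform_grid (1/2) (N2 j)) - map_vec u' (uniform_grid (1/2) (N2 j))" for j
  define h where "h j = max (mesh_size (N1 j)) (mesh_size (N2 j))" for j
  let ?q = "min p1 p2"
  have O1: "(\<lambda>j. nrm1 j (e1 j)) \<in> O(\<lambda>j. h j powr ?q)"
  proof (rule bigo_powr_weaken)
    show "(\<lambda>j. nrm1 j (e1 j)) \<in> O(\<lambda>j. mesh_size (N1 j) powr p1)"
      using con1[unfolded consistent_of_order_def, rule_format, OF restrict] by (simp add: e1_def)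
  qed (use p mesh_size_bounds[OF N(1)] in \<open>auto simp: h_def\<close>)
  have O2: "(\<lambda>j. nrm2 j (e2 j)) \<in> O(\<lambda>j. h j powr ?q)"
  proof (rule bigo_powr_weaken)
    show "(\<lambda>j. nrm2 j (e2 j)) \<in> O(\<lambda>j. mesh_size (N2 j) powr p2)"
      using con2[unfolded consistent_of_order_def, rule_format, OF restrict] by (simp add: e2_def)
  qed (use p mesh_size_bounds[OF N(2)] in \<open>auto simp: h_def\<close>)
  have "\<bar>nrm j (multiblock_diff (N1 j) (N2 j) (H1 j) (H2 j) (D1 j) (D2 j) *\<^sub>v map_vec u (multiblock_grid (N1 j) (N2 j))
      - map_vec u' (multiblock_grid (N1 j) (N2 j)))\<bar> \<le> B * (\<bar>nrm1 j (e1 j)\<bar> + \<bar>nrm2 j (e2 j)\<bar>)" for j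
  proof -
    interpret multiblock "N1 j" "N2 j" "H1 j" "H2 j" "D1 j" "D2 j" by (rule mb)
    have "e1 j \<in> carrier_vec (N1 j + 1)" "e2 j \<in> carrier_vec (N2 j + 1)"
      using D1 D2 by (auto simp: e1_def e2_def uniform_grid_def intro!: carrier_vecI)
    from stable[OF this] show ?thesis
      unfolding truncation_error[OF N(1)] e1_def e2_def .
  qed
  then have "(\<lambda>j. nrm j (multiblock_diff (N1 j) (N2 j) (H1 j) (H2 j) (D1 j) (D2 j) *\<^sub>v map_vec u (multiblock_grid (N1 j) (N2 j))
      - map_vec u' (multiblock_grid (N1 j) (N2 j)))) \<in> O(\<lambda>j. \<bar>nrm1 j (e1 j)\<bar> + \<bar>nrm2 j (e2 j)\<bar>)"
    by (intro bigoI[of _ B] always_eventually) auto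
  also have "(\<lambda>j. \<bar>nrm1 j (e1 j)\<bar> + \<bar>nrm2 j (e2 j)\<bar>) \<in> O(\<lambda>j. h j powr ?q)"
    using O1 O2 by (intro sum_in_bigo) auto
  finally show "(\<lambda>j. nrm j (multiblock_diff (N1 j) (N2 j) (H1 j) (H2 j) (D1 j) (D2 j) *\<^sub>v map_vec u (multiblock_grid (N1 j) (N2 j))
      - map_vec u' (multiblock_grid (N1 j) (N2 j)))) \<in> O(\<lambda>j. max (mesh_size (N1 j)) (mesh_size (N2 j)) powr ?q)"
    by (simp add: h_def)
qed

theorem proposition67:
  fixes N1 N2 :: "nat \<Rightarrow> nat"
    and H1 H2 D1 D2 :: "nat \<Rightarrow> real mat"
  defines "H \<equiv> \<lambda>j. multiblock_norm (N1 j) (N2 j) (H1 j) (H2 j)"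
    and "D \<equiv> \<lambda>j. multiblock_diff (N1 j) (N2 j) (H1 j) (H2 j) (D1 j) (D2 j)"
    and "E \<equiv> \<lambda>j. embedding (N1 j) (N2 j)"
    and "h1 \<equiv> \<lambda>j. mesh_size (N1 j)"
    and "h2 \<equiv> \<lambda>j. mesh_size (N2 j)"
    and "x1 \<equiv> \<lambda>j. uniform_grid 0 (N1 j)"
    and "x2 \<equiv> \<lambda>j. uniform_grid (1/2) (N2 j)"
    and "x \<equiv> \<lambda>j. multiblock_grid (N1 j) (N2 j)"
  assumes "\<And>j. N1 j \<ge> 1" and "\<And>j. N2 j \<ge> 1"
    and "filterlim N1 at_top sequentially" and "filterlim N2 at_top sequentially"
    and "\<And>j. sym_pos_def (N1 j + 1) (H1 j)" and "\<And>j. sym_pos_def (N2 j + 1) (H2 j)"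
    and "\<And>j. D1 j \<in> carrier_mat (N1 j + 1) (N1 j + 1)"
    and "\<And>j. D2 j \<in> carrier_mat (N2 j + 1) (N2 j + 1)"
    and "\<And>j. summation_by_parts (N1 j) (H1 j) (D1 j)"
    and "\<And>j. summation_by_parts (N2 j) (H2 j) (D2 j)"
  shows
    "(\<forall>j. summation_by_parts (N1 j + N2 j) (H j) (D j)) \<and>
     (\<forall>p1>0. \<forall>p2>0.
        consistent_of_order (\<lambda>j. inner_norm (H1 j)) {0..1/2} x1 h1 D1 p1 \<and>
        consistent_of_order (\<lambda>j. inner_norm (H2 j)) {1/2..1} x2 h2 D2 p2 \<longrightarrow>
        consistent_of_order (\<lambda>j. inner_norm (H j)) {0..1} x (\<lambda>j. max (h1 j) (h2 j)) D (min p1 p2)) \<and>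
     (uniform_L2_equiv N1 H1 \<and> uniform_L2_equiv N2 H2 \<longrightarrow>
      (\<forall>p1>0. \<forall>p2>0.
        consistent_of_order (\<lambda>j. max_norm) {0..1/2} x1 h1 D1 p1 \<and>
        consistent_of_order (\<lambda>j. max_norm) {1/2..1} x2 h2 D2 p2 \<longrightarrow>
        consistent_of_order (\<lambda>j. max_norm) {0..1} x (\<lambda>j. max (h1 j) (h2 j)) D (min p1 p2))) \<and>
     (\<forall>j. D j = pseudoinverse (N1 j + N2 j + 1) (N1 j + N2 j + 2)
                  (H j) (block_diag (H1 j) (H2 j)) (E j) * block_diag (D1 j) (D2 j) * E j)"
proof -
  note N = assms(9,10) and sbp = assms(17,18)
  have mb: "multiblock (N1 j) (N2 j) (H1 j) (H2 j) (D1 j) (D2 j)" for j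
    by (rule multiblock.intro) (fact assms)+
  have "\<forall>j. summation_by_parts (N1 j + N2 j) (H j) (D j)"
    unfolding H_def D_def by (intro allI multiblock.summation_by_parts_diff mb sbp)
  moreover have "consistent_of_order (\<lambda>j. inner_norm (H j)) {0..1} x (\<lambda>j. max (h1 j) (h2 j)) D (min p1 p2)"
    if p: "p1 > 0" "p2 > 0"
      and con: "consistent_of_order (\<lambda>j. inner_norm (H1 j)) {0..1/2} x1 h1 D1 p1"
        "consistent_of_order (\<lambda>j. inner_norm (H2 j)) {1/2..1} x2 h2 D2 p2" for p1 p2
    unfolding D_def x_def h1_def h2_def
  proof (rule multiblock_consistent[where B = 1, OF mb N _ p con[unfolded x1_def x2_def h1_def h2_def]])
    fix j and a b :: "real vec"
    assume a: "a \<in> carrier_vec (N1 j + 1)" and b: "b \<in> carrier_vec (N2 j + 1)"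
    interpret multiblock "N1 j" "N2 j" "H1 j" "H2 j" "D1 j" "D2 j" by (rule mb)
    have "retraction *\<^sub>v (a @\<^sub>v b) \<in> carrier_vec (N1 j + N2 j + 1)"
      by (rule mult_mat_vec_carrier[OF retraction_carrier append_carrier_vec[OF a b]])
    then have "0 \<le> inner_norm (H j) (retraction *\<^sub>v (a @\<^sub>v b))"
      unfolding inner_norm_def H_def by (intro real_sqrt_ge_zero inner_mat_nonneg[OF pulled_back_sym_pos_def])
    then have "\<bar>inner_norm (H j) (retraction *\<^sub>v (a @\<^sub>v b))\<bar> \<le> inner_norm (H1 j) a + inner_norm (H2 j) b"
      using inner_norm_retraction_le[OF a b] by (simp add: H_def)
    also have "\<dots> \<le> 1 * (\<bar>inner_norm (H1 j) a\<bar> + \<bar>inner_norm (H2 j) b\<bar>)"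
      by (simp add: add_mono)
    finally show "\<bar>inner_norm (H j) (retraction *\<^sub>v (a @\<^sub>v b))\<bar>
        \<le> 1 * (\<bar>inner_norm (H1 j) a\<bar> + \<bar>inner_norm (H2 j) b\<bar>)" .
  qed
  moreover have "consistent_of_order (\<lambda>j. max_norm) {0..1} x (\<lambda>j. max (h1 j) (h2 j)) D (min p1 p2)"
    if eqv: "uniform_L2_equiv N1 H1" "uniform_L2_equiv N2 H2"
      and p: "p1 > 0" "p2 > 0"
      and con: "consistent_of_order (\<lambda>j. max_norm) {0..1/2} x1 h1 D1 p1"
        "consistent_of_order (\<lambda>j. max_norm) {1/2..1} x2 h2 D2 p2" for p1 p2
  proof -
    obtain c1 C1 where c1: "c1 > 0" "\<And>j x. x \<in> carrier_vec (N1 j + 1) \<Longrightarrow>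
        c1 * (mesh_size (N1 j) * (x \<bullet> x)) \<le> inner_mat (H1 j) x x \<and>
        inner_mat (H1 j) x x \<le> C1 * (mesh_size (N1 j) * (x \<bullet> x))"
      using eqv(1) unfolding uniform_L2_equiv_def by blast
    obtain c2 C2 where c2: "c2 > 0" "\<And>j x. x \<in> carrier_vec (N2 j + 1) \<Longrightarrow>
        c2 * (mesh_size (N2 j) * (x \<bullet> x)) \<le> inner_mat (H2 j) x x \<and>
        inner_mat (H2 j) x x \<le> C2 * (mesh_size (N2 j) * (x \<bullet> x))"
      using eqv(2) unfolding uniform_L2_equiv_def by blast
    define B where "B = 1 + max (sqrt (C1 / c1)) (sqrt (C2 / c2))"
    show ?thesis
      unfolding D_def x_def h1_def h2_def
    proof (rule multiblock_consistent[where B = B, OF mb N _ p con[unfolded x1_def x2_def h1_def h2_def]])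
      fix j and a b :: "real vec"
      assume a: "a \<in> carrier_vec (N1 j + 1)" and b: "b \<in> carrier_vec (N2 j + 1)"
      interpret multiblock "N1 j" "N2 j" "H1 j" "H2 j" "D1 j" "D2 j" by (rule mb)
      have "retraction *\<^sub>v (a @\<^sub>v b) \<in> carrier_vec (N1 j + N2 j + 1)"
        by (rule mult_mat_vec_carrier[OF retraction_carrier append_carrier_vec[OF a b]])
      then have "\<bar>max_norm (retraction *\<^sub>v (a @\<^sub>v b))\<bar> = max_norm (retraction *\<^sub>v (a @\<^sub>v b))"
        "\<bar>max_norm a\<bar> = max_norm a" "\<bar>max_norm b\<bar> = max_norm b"
        using a b by (simp_all only: abs_of_nonneg[OF max_norm_nonneg])
      then show "\<bar>max_norm (retraction *\<^sub>v (a @\<^sub>v b))\<bar> \<le> B * (\<bar>max_norm a\<bar> + \<bar>max_norm b\<bar>)"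
        using max_norm_retraction_le[OF a b N c1(1) c2(1) c1(2) c2(2)] by (simp only: B_def)
    qed
  qed
  moreover have "\<forall>j. D j = pseudoinverse (N1 j + N2 j + 1) (N1 j + N2 j + 2)
      (H j) (block_diag (H1 j) (H2 j)) (E j) * block_diag (D1 j) (D2 j) * E j"
    unfolding H_def D_def E_def by (intro allI multiblock.diff_eq_pseudoinverse mb)
  ultimately show ?thesis by blast
qed

end
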